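(* For $q\in\{0,1\}$ consider the problem $$(\mathrm P_q)\qquad\begin{aligned}\underset{X\in L_\infty(\Omega),\ z\in\mathbb C^p}{\text{minimize}}\quad &\|X\|_{L_q}\\ \text{subject to}\quad & g_i(z)\le 0,\quad i=1,\dots,m,\\ & z=\int_\Omega F[X(\beta),\beta]\,d\beta,\\ & |X(\beta)|\le\Gamma\ \text{ for a.e. }\beta\in\Omega,\end{aligned}$$ where $\Gamma>0$. For $\mu\in\mathbb C^p$ and $\beta\in\Omega$ let $$x^o(\mu,\beta)=\operatorname*{argmin}_{x\in\mathbb C,\ |x|\le\Gamma}\ |x|+\mathrm{Re}\left[\mu^T F(x,\beta)\right],$$ and suppose that $x^o$ saturates, i.e., $x^o(\mu,\beta)\neq 0\Rightarrow|x^o(\mu,\beta)|=\Gamma$ for all $\mu\in\mathbb C^p$ and $\beta\in\Omega$. Suppose also that Slater's condition holds: there exist $X'\in L_\infty(\Omega)$ with $|X'|\le\Gamma$ a.e. and $z'=\int_\Omega F[X'(\beta),\beta]\,d\beta$ such that $g_i(z')<0$ for all $i=1,\dots,m$. If $P_0^\star$ and $P_1^\star$ denote the optimal values of $(\mathrm P_0)$ and $(\mathrm P_1)$, respectively, then $$P_0^\star=\frac{P_1^\star}{\Gamma}.$$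
   Context: $\Omega\subset\mathbb R^n$ is compact; all integrals are with respect to Lebesgue measure $\mathfrak m$, and $L_\infty(\Omega)$ consists of (complex-valued) essentially bounded measurable functions on $\Omega$. $\|X\|_{L_0}=\mathfrak m(\{\beta\in\Omega:X(\beta)\ne0\})$ (not a norm) and $\|X\|_{L_1}=\int_\Omega|X(\beta)|\,d\beta$. The functions $g_i:\mathbb C^p\to\mathbb R$ are convex. $F:\mathbb C\times\Omega\to\mathbb C^p$ is a possibly nonlinear function whose components (real and imaginary parts) are normal integrands (e.g. Carathéodory functions: continuous in $x$ for each fixed $\beta$ and measurable in $\beta$ for each fixed $x$), containing no Dirac deltas, and the integrals $\int_\Omega F[X(\beta),\beta]\,d\beta$ are assumed well defined and finite for the functions $X$ under consideration. The argmin denotes a minimizer of the stated scalar problem. Optimal values are infima over the feasible set. *)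

theory Defs
  imports "HOL-Analysis.Analysis"
begin

text \<open>
  Functions on \<open>\<Omega>\<close> are represented by total functions, of which only the restriction to
  \<open>\<Omega>\<close> matters; almost-everywhere equal functions are not identified, as every notion
  below is invariant under changes on null sets.
\<close>

definition L_infty :: "(real^'n) set \<Rightarrow> (real^'n \<Rightarrow> complex) set" where
  "L_infty \<Omega> = {X \<in> borel_measurable (lebesgue_on \<Omega>).
     \<exists>B::real. AE \<beta> in lebesgue_on \<Omega>. cmod (X \<beta>) \<le> B}"

text \<open>The objectives take values in \<open>ennreal\<close>, so that infima are total
  (with value \<open>\<infinity>\<close> for an infeasible problem).\<close>

definition L0_norm :: "(real^'n) set \<Rightarrow> (real^'n \<Rightarrow> complex) \<Rightarrow> ennreal" where
  "L0_norm \<Omega> X = emeasure lebesgue {\<beta> \<in> \<Omega>. X \<beta> \<noteq> 0}"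

definition L1_norm :: "(real^'n) set \<Rightarrow> (real^'n \<Rightarrow> complex) \<Rightarrow> ennreal" where
  "L1_norm \<Omega> X = (\<integral>\<^sup>+ \<beta>. ennreal (cmod (X \<beta>)) \<partial>lebesgue_on \<Omega>)"

text \<open>Normal integrands in the sense of Rockafellar: the epigraph multifunction
  \<open>\<beta> \<mapsto> epi f(\<cdot>, \<beta>)\<close> is closed-valued and measurable, i.e. preimages of open sets
  are measurable.\<close>

definition normal_integrand ::
    "'b measure \<Rightarrow> ('a::real_normed_vector \<Rightarrow> 'b \<Rightarrow> real) \<Rightarrow> bool" where
  "normal_integrand M f \<longleftrightarrow>
     (\<forall>\<beta>\<in>space M. closed (epigraph UNIV (\<lambda>x. f x \<beta>))) \<and>
     (\<forall>U. open U \<longrightarrow> {\<beta> \<in> space M. epigraph UNIV (\<lambda>x. f x \<beta>) \<inter> U \<noteq> {}} \<in> sets M)"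

definition admissible :: "(real^'n) set \<Rightarrow> real \<Rightarrow> (real^'n \<Rightarrow> complex) set" where
  "admissible \<Omega> \<Gamma> = {X \<in> L_infty \<Omega>. AE \<beta> in lebesgue_on \<Omega>. cmod (X \<beta>) \<le> \<Gamma>}"

definition feasible_set ::
    "(real^'n) set \<Rightarrow> (complex \<Rightarrow> real^'n \<Rightarrow> complex^'p) \<Rightarrow> nat \<Rightarrow> (nat \<Rightarrow> complex^'p \<Rightarrow> real)
      \<Rightarrow> real \<Rightarrow> ((real^'n \<Rightarrow> complex) \<times> (complex^'p)) set" where
  "feasible_set \<Omega> F m g \<Gamma> = {(X, z). X \<in> admissible \<Omega> \<Gamma> \<and>
     (\<forall>i\<in>{1..m}. g i z \<le> 0) \<and>
     z = (LINT \<beta>|lebesgue_on \<Omega>. F (X \<beta>) \<beta>)}"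

definition P0_star ::
    "(real^'n) set \<Rightarrow> (complex \<Rightarrow> real^'n \<Rightarrow> complex^'p) \<Rightarrow> nat \<Rightarrow> (nat \<Rightarrow> complex^'p \<Rightarrow> real)
      \<Rightarrow> real \<Rightarrow> ennreal" where
  "P0_star \<Omega> F m g \<Gamma> = (INF (X, z) \<in> feasible_set \<Omega> F m g \<Gamma>. L0_norm \<Omega> X)"

definition P1_star ::
    "(real^'n) set \<Rightarrow> (complex \<Rightarrow> real^'n \<Rightarrow> complex^'p) \<Rightarrow> nat \<Rightarrow> (nat \<Rightarrow> complex^'p \<Rightarrow> real)
      \<Rightarrow> real \<Rightarrow> ennreal" where
  "P1_star \<Omega> F m g \<Gamma> = (INF (X, z) \<in> feasible_set \<Omega> F m g \<Gamma>. L1_norm \<Omega> X)"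

text \<open>\<open>scalar_product\<close> is the bilinear product \<open>\<mu>\<^sup>T v\<close>, without conjugation.\<close>

definition scalar_lagrangian ::
    "(complex \<Rightarrow> real^'n \<Rightarrow> complex^'p) \<Rightarrow> complex^'p \<Rightarrow> real^'n \<Rightarrow> complex \<Rightarrow> real" where
  "scalar_lagrangian F \<mu> \<beta> x = cmod x + Re (scalar_product \<mu> (F x \<beta>))"

end

theory Submission
  imports Defs
begin

text \<open>
  On functions with \<open>|Y| \<in> {0, \<Gamma>}\<close> the two objectives agree up to the factor \<open>\<Gamma>\<close>, and
  \<open>\<parallel>X\<parallel>\<^sub>1 \<le> \<Gamma> \<parallel>X\<parallel>\<^sub>0\<close> always holds, so it suffices to approximate any admissible pair
  \<open>(\<parallel>X\<parallel>\<^sub>1, \<integral>F(X))\<close> from above in cost by such \<open>Y\<close>. The closure of the values attained by these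
  \<open>Y\<close> (with slack in the cost) is convex by an approximate Lyapunov theorem; a point outside it
  would be separated by a functional \<open>(\<alpha>, w)\<close> with \<open>\<alpha> > 0\<close>, contradicting that the pointwise
  Lagrangian is minimized by saturated values, once a measurable near-minimizer is selected.
  Moving slightly towards the Slater point first makes the constraints strict, hence stable under
  the approximation.
\<close>

section \<open>Approximate convexity of vector integrals\<close>

text \<open>Sweep a half-space orthogonal to one coordinate axis across \<open>B\<close>.
  Hyperplanes are null, so the measure of the part already covered depends continuously on the
  level, and the intermediate value theorem yields every fraction.\<close>

lemma lmeasurable_subset_fraction:
  fixes B :: "'a::euclidean_space set"
  assumes "B \<in> sets lebesgue" "bounded B" "0 \<le> t" "t \<le> 1"
  shows "\<exists>A \<in> sets lebesgue. A \<subseteq> B \<and> measure lebesgue A = t * measure lebesgue B"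
proof -
  obtain k :: 'a where k: "k \<in> Basis" using nonempty_Basis by blast
  have B: "B \<in> lmeasurable" using assms bounded_set_imp_lmeasurable by blast
  obtain R where R: "\<And>x. x \<in> B \<Longrightarrow> norm x \<le> R" using \<open>bounded B\<close> bounded_iff by blast
  \<comment> \<open>The added 1 makes the bounds strict, so that \<open>H (- R')\<close> is empty.
    The absolute value covers an empty \<open>B\<close>, where \<open>R\<close> may be
    negative.\<close>
  define R' where "R' = \<bar>R\<bar> + 1"
  have bd: "- R' < x \<bullet> k \<and> x \<bullet> k < R'" if "x \<in> B" for x
    using R[OF that] Basis_le_norm[OF k, of x] unfolding R'_def by linarith
  define H where "H r = B \<inter> {x. x \<bullet> k \<le> r}" for r
  have H: "H r \<in> lmeasurable" for r
    unfolding H_def by (intro fmeasurable_Int_fmeasurable B lmeasurable_iff_integrable[THEN iffD1])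
      (auto intro!: borel_closed closed_halfspace_component_le simp: sets_completionI_sets)
  have "continuous_on UNIV (\<lambda>r. measure lebesgue (H r))"
    unfolding continuous_on_sequentially
  proof (safe, unfold comp_def)
    fix u and r :: real assume u: "u \<longlonglongrightarrow> r"
    have "(\<lambda>i. integral\<^sup>L lebesgue (indicator (H (u i)) :: 'a \<Rightarrow> real)) \<longlonglongrightarrow> integral\<^sup>L lebesgue (indicator (H r))"
    proof (rule integral_dominated_convergence[where w="indicator B"])
      \<comment> \<open>Off this hyperplane the indicators are eventually constant along
        \<open>u\<close>.\<close>
      have "{x. x \<bullet> k = r} \<in> null_sets lebesgue"
        using negligible_standard_hyperplane[OF k, of r] negligible_iff_null_sets by blast
      then show "AE x in lebesgue. (\<lambda>i. indicator (H (u i)) x :: real) \<longlonglongrightarrow> indicator (H r) x"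
      proof (rule AE_I')
        show "{x \<in> space lebesgue. \<not> (\<lambda>i. indicator (H (u i)) x :: real) \<longlonglongrightarrow> indicator (H r) x} \<subseteq> {x. x \<bullet> k = r}"
        proof (safe, rule ccontr)
          fix x assume *: "\<not> (\<lambda>i. indicator (H (u i)) x :: real) \<longlonglongrightarrow> indicator (H r) x" "x \<bullet> k \<noteq> r"
          have "\<forall>\<^sub>F i in sequentially. (indicator (H (u i)) x :: real) = indicator (H r) x"
          proof (cases "x \<bullet> k < r")
            case True
            from order_tendstoD(1)[OF u this] show ?thesis
              by eventually_elim (use True in \<open>auto simp: H_def indicator_def\<close>)
          next
            case False
            with * have "r < x \<bullet> k" by simp
            from order_tendstoD(2)[OF u this] show ?thesis
              by eventually_elim (use False * in \<open>auto simp: H_def indicator_def\<close>)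
          qed
          with *(1) show False by (simp add: tendsto_eventually)
        qed
      qed
      show "AE x in lebesgue. norm (indicator (H (u i)) x :: real) \<le> indicator B x" for i
        by (auto simp: H_def indicator_def)
    qed (use H B in \<open>auto simp: fmeasurable_def intro!: borel_measurable_indicator\<close>)
    then show "(\<lambda>i. measure lebesgue (H (u i))) \<longlonglongrightarrow> measure lebesgue (H r)"
      by simp
  qed
  moreover have "H (- R') = {}" "H R' = B"
    using bd unfolding H_def by (force intro: less_imp_le)+
  moreover have "t * measure lebesgue B \<le> measure lebesgue B"
    using assms by (simp add: mult_left_le_one_le)
  ultimately obtain r where "measure lebesgue (H r) = t * measure lebesgue B"
    using IVT'[of "\<lambda>r. measure lebesgue (H r)" "- R'" "t * measure lebesgue B" R'] \<open>0 \<le> t\<close>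
    by (auto simp: R'_def intro: continuous_on_subset)
  then show ?thesis using H[of r] by (intro bexI[of _ "H r"]) (auto simp: H_def fmeasurable_def)
qed

text \<open>On a simple function every level set can be split in the ratio \<^term>\<open>t\<close> exactly, so
  density of simple functions gives this approximate substitute for Lyapunov's theorem.\<close>

lemma approx_Lyapunov:
  fixes f :: "'a::euclidean_space \<Rightarrow> 'b::{banach, second_countable_topology}"
  assumes \<Omega>: "\<Omega> \<in> sets lebesgue" "bounded \<Omega>" and f: "integrable (lebesgue_on \<Omega>) f"
    and t: "0 \<le> t" "t \<le> 1" and "\<epsilon> > 0"
  shows "\<exists>A \<in> sets (lebesgue_on \<Omega>).
    norm ((LINT x|lebesgue_on \<Omega>. indicator A x *\<^sub>R f x) - t *\<^sub>R (LINT x|lebesgue_on \<Omega>. f x)) < \<epsilon>"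
proof -
  let ?M = "lebesgue_on \<Omega>"
  have \<Omega>lm: "\<Omega> \<in> lmeasurable" using \<Omega> bounded_set_imp_lmeasurable by blast
  interpret finite_measure ?M using finite_measure_lebesgue_on[OF \<Omega>lm] .
  \<comment> \<open>Bochner integrability is by definition approximation by simple functions in the
    mean; one approximant within \<epsilon> is kept.\<close>
  from f obtain v where "has_bochner_integral ?M f v" by (auto simp: integrable.simps)
  then obtain s where s: "Bochner_Integration.simple_bochner_integrable ?M s"
    and fs: "(\<integral>\<^sup>+x. norm (f x - s x) \<partial>?M) < ennreal \<epsilon>"
  proof cases
    case (1 s)
    from order_tendstoD(2)[OF 1(3), of "ennreal \<epsilon>"] \<open>\<epsilon> > 0\<close>
    have "\<forall>\<^sub>F i in sequentially. (\<integral>\<^sup>+x. norm (f x - s i x) \<partial>?M) < ennreal \<epsilon>" by simp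
    then obtain i where "(\<integral>\<^sup>+x. norm (f x - s i x) \<partial>?M) < ennreal \<epsilon>"
      by (auto simp: eventually_sequentially)
    then show ?thesis using that[of "s i"] 1(2)[of i] by simp
  qed
  have sf: "simple_function ?M s" using s by (auto elim: Bochner_Integration.simple_bochner_integrable.cases)
  have si: "integrable ?M s"
    using has_bochner_integral_simple_bochner_integrable[OF s] by (rule integrable.intros)
  define L where "L y = s -` {y} \<inter> \<Omega>" for y
  have Ls: "L y \<in> sets ?M" for y
    using simple_functionD(2)[OF sf, of "{y}"] by (simp add: L_def)
  have "\<exists>A \<in> sets lebesgue. A \<subseteq> L y \<and> measure lebesgue A = t * measure lebesgue (L y)" for y
  proof (rule lmeasurable_subset_fraction)
    show "L y \<in> sets lebesgue" using Ls[of y] \<Omega> by (simp add: sets_restrict_space_iff)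
    show "bounded (L y)" using \<Omega>(2) bounded_subset unfolding L_def by blast
  qed (use t in auto)
  then obtain A where A: "\<And>y. A y \<in> sets lebesgue" "\<And>y. A y \<subseteq> L y"
    "\<And>y. measure lebesgue (A y) = t * measure lebesgue (L y)" by metis
  have As: "A y \<in> sets ?M" for y
    using A(1,2)[of y] \<Omega> by (auto simp: sets_restrict_space_iff L_def)
  have mA: "measure ?M (A y) = t * measure ?M (L y)" for y
    using A(3)[of y] A(2)[of y] \<Omega> by (subst (1 2) measure_restrict_space) (auto simp: L_def)
  \<comment> \<open>\<open>D\<close> takes the fraction \<open>t\<close> of every level set of
    \<open>s\<close>, so restricting \<open>s\<close> to \<open>D\<close> multiplies its integral by
    exactly \<open>t\<close>.\<close>
  define D where "D = (\<Union>y \<in> s ` \<Omega>. A y)"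
  have fin: "finite (s ` \<Omega>)" using simple_functionD(1)[OF sf] by simp
  have Ds: "D \<in> sets ?M" unfolding D_def using fin As by (intro sets.finite_UN)
  have s_eq: "s x = (\<Sum>y\<in>s ` \<Omega>. indicator (L y) x *\<^sub>R y)" if "x \<in> \<Omega>" for x
  proof -
    have "(\<Sum>y\<in>s ` \<Omega>. indicator (L y) x *\<^sub>R y) = (\<Sum>y\<in>s ` \<Omega>. if y = s x then y else 0)"
      using that by (intro sum.cong) (auto simp: L_def indicator_def)
    then show ?thesis using fin that by simp
  qed
  have Ds_eq: "indicator D x *\<^sub>R s x = (\<Sum>y\<in>s ` \<Omega>. indicator (A y) x *\<^sub>R y)" if "x \<in> \<Omega>" for x
  proof -
    have *: "x \<in> A y \<longleftrightarrow> y = s x \<and> x \<in> D" if "y \<in> s ` \<Omega>" for y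
    proof -
      have "y' = s x" if "x \<in> A y'" for y' using A(2)[of y'] that by (auto simp: L_def)
      with that show ?thesis unfolding D_def by (metis UN_E UN_I)
    qed
    have "(\<Sum>y\<in>s ` \<Omega>. indicator (A y) x *\<^sub>R y) = (\<Sum>y\<in>s ` \<Omega>. if y = s x then indicator D x *\<^sub>R y else 0)"
      using * by (intro sum.cong) (auto simp: indicator_def)
    then show ?thesis using fin that by simp
  qed
  have hL: "has_bochner_integral ?M (\<lambda>x. indicator (L y) x *\<^sub>R y) (measure ?M (L y) *\<^sub>R y)" for y
    using Ls by (intro has_bochner_integral_indicator) (auto simp: less_top[symmetric])
  have hA: "has_bochner_integral ?M (\<lambda>x. indicator (A y) x *\<^sub>R y) (measure ?M (A y) *\<^sub>R y)" for y
    using As by (intro has_bochner_integral_indicator) (auto simp: less_top[symmetric])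
  have "(LINT x|?M. s x) = (LINT x|?M. (\<Sum>y\<in>s ` \<Omega>. indicator (L y) x *\<^sub>R y))"
    by (rule Bochner_Integration.integral_cong[OF refl], rule s_eq) simp
  also have "\<dots> = (\<Sum>y\<in>s ` \<Omega>. measure ?M (L y) *\<^sub>R y)"
    by (rule has_bochner_integral_integral_eq[OF has_bochner_integral_sum[OF hL]])
  finally have int_s: "(LINT x|?M. s x) = (\<Sum>y\<in>s ` \<Omega>. measure ?M (L y) *\<^sub>R y)" .
  have "(LINT x|?M. indicator D x *\<^sub>R s x) = (LINT x|?M. (\<Sum>y\<in>s ` \<Omega>. indicator (A y) x *\<^sub>R y))"
    by (rule Bochner_Integration.integral_cong[OF refl], rule Ds_eq) simp
  also have "\<dots> = (\<Sum>y\<in>s ` \<Omega>. measure ?M (A y) *\<^sub>R y)"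
    by (rule has_bochner_integral_integral_eq[OF has_bochner_integral_sum[OF hA]])
  also have "\<dots> = t *\<^sub>R (LINT x|?M. s x)"
    unfolding int_s scaleR_sum_right mA by simp
  finally have split_s: "(LINT x|?M. indicator D x *\<^sub>R s x) = t *\<^sub>R (LINT x|?M. s x)" .
  have iDf: "integrable ?M (\<lambda>x. indicator D x *\<^sub>R f x)" and iDs: "integrable ?M (\<lambda>x. indicator D x *\<^sub>R s x)"
    using Ds f si by (auto intro: integrable_mult_indicator)
  have h_int: "integrable ?M (\<lambda>x. (indicator D x - t) *\<^sub>R (f x - s x))"
    using iDf iDs f si by (simp add: scaleR_left_diff_distrib scaleR_right_diff_distrib)
  \<comment> \<open>The contribution of \<open>s\<close> cancels by \<open>split_s\<close>. The
    factor \<open>indicator D x - t\<close> has modulus at most 1, so the error is bounded by the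
    mean distance from \<open>f\<close> to \<open>s\<close>.\<close>
  have "(LINT x|?M. indicator D x *\<^sub>R f x) - t *\<^sub>R (LINT x|?M. f x)
      = (LINT x|?M. (indicator D x - t) *\<^sub>R (f x - s x))"
    using iDf iDs f si split_s by (simp add: scaleR_left_diff_distrib scaleR_right_diff_distrib)
  also have "ennreal (norm \<dots>) \<le> (\<integral>\<^sup>+x. norm ((indicator D x - t) *\<^sub>R (f x - s x)) \<partial>?M)"
    by (rule integral_norm_bound_ennreal[OF h_int])
  also have "\<dots> \<le> (\<integral>\<^sup>+x. norm (f x - s x) \<partial>?M)"
    using t by (intro nn_integral_mono ennreal_leI) (auto simp: indicator_def intro!: mult_left_le_one_le)
  also note fs
  finally show ?thesis using Ds \<open>\<epsilon> > 0\<close> by (intro bexI[of _ D]) (auto simp: ennreal_less_iff)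
qed

text \<open>The hypothesis passes to the closure one argument at a time: the preimage of
  \<open>closure S\<close> under an affine map is closed, and if it contains \<open>S\<close> it
  contains \<open>closure S\<close>. First \<open>x\<close> moves with \<open>y\<close> in
  \<open>S\<close>, then \<open>y\<close>.\<close>

lemma convex_closureI:
  fixes S :: "'a::real_normed_vector set"
  assumes "\<And>x y t. \<lbrakk>x \<in> S; y \<in> S; 0 \<le> t; t \<le> 1\<rbrakk> \<Longrightarrow> t *\<^sub>R x + (1 - t) *\<^sub>R y \<in> closure S"
  shows "convex (closure S)"
proof -
  have cl: "closed ((\<lambda>x. t *\<^sub>R x + c) -` closure S)" "closed ((\<lambda>x. c + t *\<^sub>R x) -` closure S)" for t :: real and c
    by (intro closed_vimage continuous_intros closed_closure)+
  have 1: "t *\<^sub>R x + (1 - t) *\<^sub>R y \<in> closure S" if "x \<in> closure S" "y \<in> S" "0 \<le> t" "t \<le> 1" for x y t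
    using closure_minimal[OF _ cl(1)[of t "(1 - t) *\<^sub>R y"]] assms that by blast
  have 2: "t *\<^sub>R x + (1 - t) *\<^sub>R y \<in> closure S" if "x \<in> closure S" "y \<in> closure S" "0 \<le> t" "t \<le> 1" for x y t
    using closure_minimal[OF _ cl(2)[of "t *\<^sub>R x" "1 - t"]] 1 that by blast
  show ?thesis
    unfolding convex_alt using 2[of _ _ "1 - _"] by simp
qed

section \<open>Measurable selection for normal integrands\<close>

text \<open>By compactness a nonnegative continuous function has a zero iff its infimum is 0, and by
  continuity this infimum can be tested on a countable dense subset. The uncountable existential
  thus becomes countable set operations.\<close>

lemma sets_Bex_zero_compact:
  fixes G :: "'a::{metric_space, second_countable_topology} \<Rightarrow> 'b \<Rightarrow> real"
  assumes K: "compact K"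
    and meas: "\<And>t. t \<in> K \<Longrightarrow> G t \<in> borel_measurable M"
    and cont: "\<And>\<beta>. \<beta> \<in> space M \<Longrightarrow> continuous_on K (\<lambda>t. G t \<beta>)"
    and nonneg: "\<And>t \<beta>. 0 \<le> G t \<beta>"
  shows "{\<beta> \<in> space M. \<exists>t\<in>K. G t \<beta> = 0} \<in> sets M"
proof -
  obtain D where D: "countable D" "D \<subseteq> K" "K \<subseteq> closure D" using separable[of K] by blast
  have "(\<exists>t\<in>K. G t \<beta> = 0) \<longleftrightarrow> (\<forall>n. \<exists>t\<in>D. G t \<beta> < 1 / Suc n)" if \<beta>: "\<beta> \<in> space M" for \<beta>
  proof
    assume "\<exists>t\<in>K. G t \<beta> = 0"
    then obtain t where t: "t \<in> K" "G t \<beta> = 0" by blast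
    show "\<forall>n. \<exists>t\<in>D. G t \<beta> < 1 / Suc n"
    proof
      fix n
      have "0 < 1 / real (Suc n)" by simp
      then obtain d where d: "d > 0" "\<And>u. u \<in> K \<Longrightarrow> dist u t < d \<Longrightarrow> dist (G u \<beta>) (G t \<beta>) < 1 / Suc n"
        using cont[OF \<beta>] t unfolding continuous_on_iff by meson
      obtain u where "u \<in> D" "dist u t < d"
        using t D d(1) by (meson closure_approachable subsetD)
      then show "\<exists>t\<in>D. G t \<beta> < 1 / Suc n"
        using d(2)[of u] D(2) t(2) nonneg[of u \<beta>] by (auto simp: dist_real_def)
    qed
  next
    assume *: "\<forall>n. \<exists>t\<in>D. G t \<beta> < 1 / Suc n"
    then have "K \<noteq> {}" using D(2) by blast
    from continuous_attains_inf[OF K this cont[OF \<beta>]]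
    obtain t where t: "t \<in> K" "\<forall>u\<in>K. G t \<beta> \<le> G u \<beta>" by blast
    have "G t \<beta> < 1 / Suc n" for n using * t D(2) by (meson le_less_trans subsetD)
    then have "\<not> 0 < G t \<beta>" by (metis less_asym nat_approx_posE)
    then show "\<exists>t\<in>K. G t \<beta> = 0" using t(1) nonneg[of t \<beta>] by (intro bexI[of _ t]) auto
  qed
  then have "{\<beta> \<in> space M. \<exists>t\<in>K. G t \<beta> = 0} = {\<beta> \<in> space M. \<forall>n. \<exists>t\<in>D. G t \<beta> < 1 / Suc n}" by blast
  also have "\<dots> \<in> sets M"
  proof -
    have "{\<beta> \<in> space M. G t \<beta> < 1 / Suc n} \<in> sets M" if "t \<in> D" for t n
      using meas[of t] that D(2) by (auto intro!: borel_measurable_less)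
    then have "(\<Union>t\<in>D. {\<beta> \<in> space M. G t \<beta> < 1 / Suc n}) \<in> sets M" for n
      using D(1) by (intro sets.countable_UN') auto
    moreover have "(\<Union>t\<in>D. {\<beta> \<in> space M. G t \<beta> < 1 / Suc n}) = {\<beta> \<in> space M. \<exists>t\<in>D. G t \<beta> < 1 / Suc n}" for n
      by blast
    ultimately have "{\<beta> \<in> space M. \<exists>t\<in>D. G t \<beta> < 1 / Suc n} \<in> sets M" for n
      by (simp only:)
    then show ?thesis by (intro sets.sets_Collect_countable_All)
  qed
  finally show ?thesis .
qed

text \<open>The selector is the smallest zero. It is at most \<open>c\<close> exactly when a zero
  exists in the compact set \<open>K \<inter> {..c}\<close>, so its sublevel sets are of the form
  just shown to be measurable.\<close>

lemma measurable_Inf_zero_compact: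
  fixes G :: "real \<Rightarrow> 'b \<Rightarrow> real"
  assumes K: "compact K"
    and meas: "\<And>t. t \<in> K \<Longrightarrow> G t \<in> borel_measurable M"
    and cont: "\<And>\<beta>. \<beta> \<in> space M \<Longrightarrow> continuous_on K (\<lambda>t. G t \<beta>)"
    and nonneg: "\<And>t \<beta>. 0 \<le> G t \<beta>"
  obtains \<tau> where "\<tau> \<in> borel_measurable M"
    "\<And>\<beta>. \<lbrakk>\<beta> \<in> space M; \<exists>t\<in>K. G t \<beta> = 0\<rbrakk> \<Longrightarrow> \<tau> \<beta> \<in> K \<and> G (\<tau> \<beta>) \<beta> = 0"
proof -
  define Z where "Z \<beta> = {t \<in> K. G t \<beta> = 0}" for \<beta>
  define S where "S c = {\<beta> \<in> space M. \<exists>t\<in>K \<inter> {..c}. G t \<beta> = 0}" for c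
  define S' where "S' = {\<beta> \<in> space M. \<exists>t\<in>K. G t \<beta> = 0}"
  define \<tau> where "\<tau> \<beta> = (if \<beta> \<in> S' then Inf (Z \<beta>) else 0)" for \<beta>
  have Sm: "S c \<in> sets M" for c
    unfolding S_def using meas nonneg continuous_on_subset[OF cont, of _ "K \<inter> {..c}"]
    by (intro sets_Bex_zero_compact compact_Int_closed K closed_atMost) auto
  have S'm: "S' \<in> sets M"
    unfolding S'_def by (intro sets_Bex_zero_compact assms)
  have \<tau>: "\<tau> \<beta> \<in> Z \<beta> \<and> (\<forall>t\<in>Z \<beta>. \<tau> \<beta> \<le> t)" if "\<beta> \<in> S'" for \<beta>
  proof -
    have \<beta>: "\<beta> \<in> space M" and ne: "Z \<beta> \<noteq> {}" using that by (auto simp: S'_def Z_def)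
    have "closed (Z \<beta>)"
      unfolding Z_def using continuous_closed_preimage[OF cont[OF \<beta>] compact_imp_closed[OF K], of "{0}"]
      by (simp add: vimage_def Int_def)
    moreover have "bdd_below (Z \<beta>)"
      using compact_imp_bounded[OF K] unfolding Z_def
      by (intro bounded_imp_bdd_below) (auto elim: bounded_subset)
    ultimately show ?thesis using ne that closed_contains_Inf[of "Z \<beta>"] cInf_lower[of _ "Z \<beta>"]
      by (auto simp: \<tau>_def)
  qed
  have "\<tau> \<in> borel_measurable M"
  proof (subst borel_measurable_iff_le, rule allI)
    fix c
    have "{\<beta> \<in> space M. \<tau> \<beta> \<le> c} = S c \<union> (if 0 \<le> c then space M - S' else {})"
    proof (rule set_eqI)
      fix \<beta>
      show "\<beta> \<in> {\<beta> \<in> space M. \<tau> \<beta> \<le> c} \<longleftrightarrow> \<beta> \<in> S c \<union> (if 0 \<le> c then space M - S' else {})"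
      proof (cases "\<beta> \<in> S'")
        case True
        then have "\<beta> \<in> S c \<longleftrightarrow> \<tau> \<beta> \<le> c"
          using \<tau>[OF True] by (force simp: S_def S'_def Z_def)
        with True show ?thesis by (auto simp: S'_def)
      next
        case False
        then show ?thesis by (auto simp: S_def S'_def \<tau>_def)
      qed
    qed
    then show "{\<beta> \<in> space M. \<tau> \<beta> \<le> c} \<in> sets M" using Sm S'm by auto
  qed
  moreover have "\<tau> \<beta> \<in> K \<and> G (\<tau> \<beta>) \<beta> = 0" if "\<beta> \<in> space M" "\<exists>t\<in>K. G t \<beta> = 0" for \<beta>
    using \<tau>[of \<beta>] that by (auto simp: S'_def Z_def)
  ultimately show ?thesis using that by blast
qed

text \<open>The distance from \<open>p\<close> is below \<open>c\<close> iff the epigraph meets the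
  open ball of radius \<open>c\<close>, which is the kind of event that the definition of a normal
  integrand makes measurable.\<close>

lemma normal_integrand_infdist_measurable:
  assumes "normal_integrand M f"
  shows "(\<lambda>\<beta>. infdist p (epigraph UNIV (\<lambda>x. f x \<beta>))) \<in> borel_measurable M"
proof (subst borel_measurable_iff_less, rule allI)
  fix c
  let ?E = "\<lambda>\<beta>. epigraph UNIV (\<lambda>x. f x \<beta>)"
  have "infdist p (?E \<beta>) < c \<longleftrightarrow> ?E \<beta> \<inter> ball p c \<noteq> {}" for \<beta>
  proof -
    have "(0, f 0 \<beta>) \<in> ?E \<beta>" by (simp add: mem_epigraph)
    then have ne: "?E \<beta> \<noteq> {}" by blast
    then have "infdist p (?E \<beta>) < c \<longleftrightarrow> (\<exists>a\<in>?E \<beta>. dist p a < c)"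
      unfolding infdist_notempty[OF ne] by (intro cINF_less_iff) auto
    then show ?thesis by auto
  qed
  then have "{\<beta> \<in> space M. infdist p (?E \<beta>) < c} = {\<beta> \<in> space M. ?E \<beta> \<inter> ball p c \<noteq> {}}" by simp
  also have "\<dots> \<in> sets M" using assms unfolding normal_integrand_def by simp
  finally show "{\<beta> \<in> space M. infdist p (?E \<beta>) < c} \<in> sets M" .
qed

lemma normal_integrand_le_iff_infdist:
  assumes "normal_integrand M f" "\<beta> \<in> space M"
  shows "f y \<beta> \<le> r \<longleftrightarrow> infdist (y, r) (epigraph UNIV (\<lambda>x. f x \<beta>)) = 0"
proof -
  have "epigraph UNIV (\<lambda>x. f x \<beta>) \<noteq> {}" by (metis UNIV_I empty_iff mem_epigraph order_refl)
  then show ?thesis using assms in_closed_iff_infdist_zero[of "epigraph UNIV (\<lambda>x. f x \<beta>)" "(y, r)"]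
    by (simp add: normal_integrand_def mem_epigraph)
qed

text \<open>This is lower semicontinuity, read off from the slice of the closed epigraph at height
  \<open>s\<close>.\<close>

lemma normal_integrand_open_Collect_greater:
  assumes "normal_integrand M f" "\<beta> \<in> space M"
  shows "open {y. s < f y \<beta>}"
proof -
  have "closed ((\<lambda>y. (y, s)) -` epigraph UNIV (\<lambda>x. f x \<beta>))"
    using assms unfolding normal_integrand_def
    by (intro closed_vimage continuous_on_Pair continuous_on_const continuous_on_id) blast
  moreover have "- ((\<lambda>y. (y, s)) -` epigraph UNIV (\<lambda>x. f x \<beta>)) = {y. s < f y \<beta>}"
    by (auto simp: mem_epigraph)
  ultimately show ?thesis unfolding closed_def by simp
qed

text \<open>Each \<open>f j\<close> is only lower semicontinuous, but the distance to its epigraph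
  is continuous in the point and measurable in \<beta>. Summing these distances turns finitely many
  upper bounds into the zero set of one such function, to which the compact selection
  applies.\<close>

lemma normal_integrand_zero_fun:
  fixes f :: "'j \<Rightarrow> 'a::real_normed_vector \<Rightarrow> 'b \<Rightarrow> real"
  assumes f: "\<And>j. normal_integrand M (f j)" and "finite J"
    and \<gamma>: "continuous_on UNIV \<gamma>"
  obtains G :: "'t::topological_space \<Rightarrow> 'b \<Rightarrow> real" where "\<And>t. G t \<in> borel_measurable M"
    "\<And>\<beta>. continuous_on UNIV (\<lambda>t. G t \<beta>)" "\<And>t \<beta>. 0 \<le> G t \<beta>"
    "\<And>t \<beta>. \<beta> \<in> space M \<Longrightarrow> G t \<beta> = 0 \<longleftrightarrow> (\<forall>j\<in>J. f j (\<gamma> t) \<beta> \<le> r j)"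
proof
  let ?G = "\<lambda>t \<beta>. \<Sum>j\<in>J. infdist (\<gamma> t, r j) (epigraph UNIV (\<lambda>x. f j x \<beta>))"
  show "?G t \<in> borel_measurable M" for t
    using normal_integrand_infdist_measurable[OF f] by (intro borel_measurable_sum)
  show "continuous_on UNIV (\<lambda>t. ?G t \<beta>)" for \<beta>
    by (intro continuous_intros \<gamma>)
  show "0 \<le> ?G t \<beta>" for t \<beta> by (intro sum_nonneg infdist_nonneg)
  show "?G t \<beta> = 0 \<longleftrightarrow> (\<forall>j\<in>J. f j (\<gamma> t) \<beta> \<le> r j)" if "\<beta> \<in> space M" for t \<beta>
    using that \<open>finite J\<close> by (simp add: sum_nonneg_eq_0_iff infdist_nonneg normal_integrand_le_iff_infdist[OF f])
qed

text \<open>Use the first index, in an enumeration, whose set contains \<beta>. Where there is none,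
  \<open>LEAST\<close> still denotes some number, so \<open>Y\<close> agrees with some
  \<open>y i\<close> everywhere.\<close>

lemma measurable_countable_choice:
  fixes B :: "'i::countable \<Rightarrow> 'b set" and y :: "'i \<Rightarrow> 'b \<Rightarrow> 'c"
  assumes B: "\<And>i. B i \<in> sets M" and y: "\<And>i. y i \<in> measurable M N"
  obtains Y where "Y \<in> measurable M N" "\<And>\<beta>. \<exists>i. Y \<beta> = y i \<beta>"
    "\<And>\<beta>. \<beta> \<in> (\<Union>i. B i) \<Longrightarrow> \<exists>i. \<beta> \<in> B i \<and> Y \<beta> = y i \<beta>"
proof
  define k where "k \<beta> = (LEAST n::nat. \<beta> \<in> B (from_nat n))" for \<beta>
  let ?Y = "\<lambda>\<beta>. y (from_nat (k \<beta>)) \<beta>"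
  have "Measurable.pred M (\<lambda>\<beta>. \<beta> \<in> B i)" for i
    using sets.Int[OF sets.top B[of i]] by (simp add: pred_def Int_def)
  then have "k \<in> measurable M (count_space UNIV)"
    unfolding k_def by (intro measurable_Least)
  then show "?Y \<in> measurable M N"
    by (rule measurable_compose_countable[rotated]) (rule y)
  show "\<exists>i. ?Y \<beta> = y i \<beta>" for \<beta> by blast
  fix \<beta> assume "\<beta> \<in> (\<Union>i. B i)"
  then obtain i where "\<beta> \<in> B i" by blast
  then have "\<beta> \<in> B (from_nat (to_nat i))" by simp
  then have "\<beta> \<in> B (from_nat (k \<beta>))" unfolding k_def by (rule LeastI)
  then show "\<exists>i. \<beta> \<in> B i \<and> ?Y \<beta> = y i \<beta>" by blast
qed

text \<open>One piece of the countable cover. The upper bounds \<open>r\<close> are required at some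
  point of the arc and select that point; the lower bounds \<open>s\<close> are required on the
  whole arc and therefore hold at whichever point is selected. Outside \<open>B\<close> the selector
  still stays on the curve.\<close>

lemma normal_integrand_local_selection:
  fixes f :: "'j::finite \<Rightarrow> complex \<Rightarrow> 'b \<Rightarrow> real" and a r s :: "'j \<Rightarrow> real"
    and \<gamma> :: "real \<Rightarrow> complex"
  assumes f: "\<And>j. normal_integrand M (f j)" and c: "c \<in> borel_measurable M"
    and \<gamma>: "continuous_on UNIV \<gamma>" and p: "\<And>t. cmod (\<gamma> t) = \<rho>"
  shows "\<exists>y B. y \<in> borel_measurable M \<and> B \<in> sets M \<and> range y \<subseteq> range \<gamma> \<and>
    (\<forall>\<beta>\<in>B. cmod (y \<beta>) + (\<Sum>j\<in>UNIV. a j * f j (y \<beta>) \<beta>) < c \<beta>) \<and>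
    (\<forall>\<beta>\<in>space M. (\<exists>t\<in>{u..v}. \<forall>j. f j (\<gamma> t) \<beta> \<le> r j) \<and>
       (\<forall>t\<in>{u..v}. \<forall>j. s j < f j (\<gamma> t) \<beta>) \<and>
       \<rho> + (\<Sum>j\<in>UNIV. if 0 \<le> a j then a j * r j else a j * s j) < c \<beta> \<longrightarrow> \<beta> \<in> B)"
proof -
  let ?c = "\<rho> + (\<Sum>j\<in>UNIV. if 0 \<le> a j then a j * r j else a j * s j)"
  obtain G :: "real \<Rightarrow> 'b \<Rightarrow> real" where G: "\<And>t. G t \<in> borel_measurable M"
    "\<And>\<beta>. continuous_on UNIV (\<lambda>t. G t \<beta>)" "\<And>t \<beta>. 0 \<le> G t \<beta>"
    "\<And>t \<beta>. \<beta> \<in> space M \<Longrightarrow> G t \<beta> = 0 \<longleftrightarrow> (\<forall>j\<in>UNIV. f j (\<gamma> t) \<beta> \<le> r j)"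
    using normal_integrand_zero_fun[of M f UNIV \<gamma> r, OF f _ \<gamma>] by (metis finite)
  obtain \<tau> where \<tau>: "\<tau> \<in> borel_measurable M"
    "\<And>\<beta>. \<lbrakk>\<beta> \<in> space M; \<exists>t\<in>{u..v}. G t \<beta> = 0\<rbrakk> \<Longrightarrow> \<tau> \<beta> \<in> {u..v} \<and> G (\<tau> \<beta>) \<beta> = 0"
    using measurable_Inf_zero_compact[of "{u..v}" G M] G continuous_on_subset by (metis compact_Icc subset_UNIV)
  \<comment> \<open>A lower bound fails somewhere on the arc iff a nonstrict upper bound holds
    there, so the same zero test applies.\<close>
  have low: "{\<beta> \<in> space M. \<exists>t\<in>{u..v}. f j (\<gamma> t) \<beta> \<le> s j} \<in> sets M" for j
  proof -
    obtain H :: "real \<Rightarrow> 'b \<Rightarrow> real" where H: "\<And>t. H t \<in> borel_measurable M"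
      "\<And>\<beta>. continuous_on UNIV (\<lambda>t. H t \<beta>)" "\<And>t \<beta>. 0 \<le> H t \<beta>"
      "\<And>t \<beta>. \<beta> \<in> space M \<Longrightarrow> H t \<beta> = 0 \<longleftrightarrow> (\<forall>j\<in>{j}. f j (\<gamma> t) \<beta> \<le> s j)"
      using normal_integrand_zero_fun[of M f "{j}" \<gamma> s, OF f _ \<gamma>] by (metis finite)
    have "{\<beta> \<in> space M. \<exists>t\<in>{u..v}. H t \<beta> = 0} \<in> sets M"
      using H(1-3) continuous_on_subset[OF H(2)] by (intro sets_Bex_zero_compact) auto
    also have "{\<beta> \<in> space M. \<exists>t\<in>{u..v}. H t \<beta> = 0} = {\<beta> \<in> space M. \<exists>t\<in>{u..v}. f j (\<gamma> t) \<beta> \<le> s j}"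
      using H(4) by auto
    finally show ?thesis .
  qed
  define B where "B = {\<beta> \<in> space M. \<exists>t\<in>{u..v}. G t \<beta> = 0} \<inter> {\<beta> \<in> space M. ?c < c \<beta>}
    - (\<Union>j. {\<beta> \<in> space M. \<exists>t\<in>{u..v}. f j (\<gamma> t) \<beta> \<le> s j})"
  have "{\<beta> \<in> space M. \<exists>t\<in>{u..v}. G t \<beta> = 0} \<in> sets M"
    using G(1-3) continuous_on_subset[OF G(2)] by (intro sets_Bex_zero_compact) auto
  moreover have "{\<beta> \<in> space M. ?c < c \<beta>} \<in> sets M" using c by measurable
  moreover have "(\<Union>j. {\<beta> \<in> space M. \<exists>t\<in>{u..v}. f j (\<gamma> t) \<beta> \<le> s j}) \<in> sets M"
    by (intro sets.finite_UN finite low)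
  ultimately have "B \<in> sets M" unfolding B_def by (intro sets.Diff sets.Int)
  moreover have "(\<lambda>\<beta>. \<gamma> (\<tau> \<beta>)) \<in> borel_measurable M"
    using \<tau>(1) borel_measurable_continuous_onI[OF \<gamma>] by (rule measurable_compose)
  moreover have "cmod (\<gamma> (\<tau> \<beta>)) + (\<Sum>j\<in>UNIV. a j * f j (\<gamma> (\<tau> \<beta>)) \<beta>) < c \<beta>" if "\<beta> \<in> B" for \<beta>
  proof -
    from that have \<beta>: "\<beta> \<in> space M" "?c < c \<beta>" "\<tau> \<beta> \<in> {u..v}" "G (\<tau> \<beta>) \<beta> = 0"
      using \<tau>(2) by (auto simp: B_def)
    then have "f j (\<gamma> (\<tau> \<beta>)) \<beta> \<le> r j" "s j < f j (\<gamma> (\<tau> \<beta>)) \<beta>" for j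
      using that G(4)[of \<beta> "\<tau> \<beta>"] by (auto simp: B_def not_le)
    \<comment> \<open>Nonnegative coefficients use the upper bounds, negative ones the lower
      bounds.\<close>
    then have "(\<Sum>j\<in>UNIV. a j * f j (\<gamma> (\<tau> \<beta>)) \<beta>) \<le> (\<Sum>j\<in>UNIV. if 0 \<le> a j then a j * r j else a j * s j)"
      by (intro sum_mono) (auto intro: mult_left_mono mult_left_mono_neg less_imp_le)
    then show ?thesis using \<beta>(2) p[of "\<tau> \<beta>"] by linarith
  qed
  moreover have "\<beta> \<in> B" if "\<beta> \<in> space M" "\<exists>t\<in>{u..v}. \<forall>j. f j (\<gamma> t) \<beta> \<le> r j"
    "\<forall>t\<in>{u..v}. \<forall>j. s j < f j (\<gamma> t) \<beta>" "?c < c \<beta>" for \<beta>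
    using that G(4) unfolding B_def by (auto simp: not_le)
  ultimately show ?thesis by (intro exI[of _ "\<lambda>\<beta>. \<gamma> (\<tau> \<beta>)"] exI[of _ B]) auto
qed

text \<open>The coefficients \<^term>\<open>a\<close> may have either sign, so the objective is not lower semicontinuous
  and its sublevel sets need not be closed. Bracketing every \<^term>\<open>f j\<close> between rationals on a
  rational arc writes them as a countable union of pieces on which the upper bounds cut out a
  compact set, where the smallest angle is a measurable selector.\<close>

lemma normal_integrand_selection:
  fixes f :: "'j::finite \<Rightarrow> complex \<Rightarrow> 'b \<Rightarrow> real" and a :: "'j \<Rightarrow> real"
  assumes f: "\<And>j. normal_integrand M (f j)" and c: "c \<in> borel_measurable M" and \<Gamma>: "0 \<le> \<Gamma>"
  obtains Y where "Y \<in> borel_measurable M" "\<And>\<beta>. Y \<beta> = 0 \<or> cmod (Y \<beta>) = \<Gamma>"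
    "\<And>\<beta> y. \<lbrakk>\<beta> \<in> space M; y = 0 \<or> cmod y = \<Gamma>; cmod y + (\<Sum>j\<in>UNIV. a j * f j y \<beta>) < c \<beta>\<rbrakk>
      \<Longrightarrow> cmod (Y \<beta>) + (\<Sum>j\<in>UNIV. a j * f j (Y \<beta>) \<beta>) < c \<beta>"
proof -
  \<comment> \<open>The point 0 and the circle of radius \<Gamma> are both treated as curves, told
    apart by the flag \<open>b\<close>.\<close>
  define \<gamma> where "\<gamma> b t = (if b then complex_of_real \<Gamma> else 0) * cis t" for b t
  have \<gamma>: "continuous_on UNIV (\<gamma> b)" "cmod (\<gamma> b t) = (if b then \<Gamma> else 0)" for b t
    using \<Gamma> unfolding \<gamma>_def by (auto intro!: continuous_intros simp: norm_mult)
  \<comment> \<open>Since \<open>'j\<close> is finite, functions from \<open>'j\<close> to the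
    rationals are countable, and so is the set of indices \<open>i\<close>.\<close>
  define Q where "Q i y B \<longleftrightarrow> y \<in> borel_measurable M \<and> B \<in> sets M \<and> range y \<subseteq> range (\<gamma> (fst i)) \<and>
    (\<forall>\<beta>\<in>B. cmod (y \<beta>) + (\<Sum>j\<in>UNIV. a j * f j (y \<beta>) \<beta>) < c \<beta>) \<and>
    (\<forall>\<beta>\<in>space M. case i of (b, (u, v), r, s) \<Rightarrow>
       (\<exists>t\<in>{of_rat u..of_rat v}. \<forall>j. f j (\<gamma> b t) \<beta> \<le> of_rat (r j)) \<and>
       (\<forall>t\<in>{of_rat u..of_rat v}. \<forall>j. of_rat (s j) < f j (\<gamma> b t) \<beta>) \<and>
       (if b then \<Gamma> else 0)
         + (\<Sum>j\<in>UNIV. if 0 \<le> a j then a j * of_rat (r j) else a j * of_rat (s j)) < c \<beta> \<longrightarrow> \<beta> \<in> B)"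
    for i :: "bool \<times> (rat \<times> rat) \<times> ('j \<Rightarrow> rat) \<times> ('j \<Rightarrow> rat)" and y B
  have "\<exists>y B. Q i y B" for i
  proof -
    obtain b u v r s where i: "i = (b, (u, v), r, s)" by (metis surj_pair)
    show ?thesis
      using normal_integrand_local_selection[of M f c "\<gamma> b" "if b then \<Gamma> else 0" a "of_rat u" "of_rat v"
          "\<lambda>j. of_rat (r j)" "\<lambda>j. of_rat (s j)", OF f c \<gamma>]
      by (simp only: Q_def i prod.case fst_conv)
  qed
  then obtain y B where "\<And>i. Q i (y i) (B i)" by metis
  note Q = this[unfolded Q_def]
  have yB: "y i \<in> borel_measurable M" "B i \<in> sets M" "range (y i) \<subseteq> range (\<gamma> (fst i))" for i
    using Q[of i] by blast+
  have yB_less: "cmod (y i \<beta>) + (\<Sum>j\<in>UNIV. a j * f j (y i \<beta>) \<beta>) < c \<beta>" if "\<beta> \<in> B i" for i \<beta>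
    using Q[of i] that by blast
  obtain Y where Y: "Y \<in> borel_measurable M" "\<And>\<beta>. \<exists>i. Y \<beta> = y i \<beta>"
    "\<And>\<beta>. \<beta> \<in> (\<Union>i. B i) \<Longrightarrow> \<exists>i. \<beta> \<in> B i \<and> Y \<beta> = y i \<beta>"
    using measurable_countable_choice[of B M y, OF yB(2,1)] by blast
  have "Y \<beta> = 0 \<or> cmod (Y \<beta>) = \<Gamma>" for \<beta>
  proof -
    obtain i where "Y \<beta> = y i \<beta>" using Y(2) by blast
    then obtain b t where "Y \<beta> = \<gamma> b t" using subsetD[OF yB(3)[of i] rangeI[of "y i" \<beta>]] by auto
    then show ?thesis using \<gamma>(2)[of b t] by (cases b) auto
  qed
  moreover have "cmod (Y \<beta>) + (\<Sum>j\<in>UNIV. a j * f j (Y \<beta>) \<beta>) < c \<beta>"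
    if \<beta>: "\<beta> \<in> space M" and z: "z = 0 \<or> cmod z = \<Gamma>" "cmod z + (\<Sum>j\<in>UNIV. a j * f j z \<beta>) < c \<beta>" for \<beta> z
  proof -
    obtain b t0 where bt: "z = \<gamma> b t0"
    proof (cases "z = 0")
      case True then show ?thesis using that[of False 0] by (simp add: \<gamma>_def)
    next
      case False
      with z(1) have "z = \<gamma> True (Arg z)"
        using rcis_cmod_Arg[of z] by (simp add: \<gamma>_def rcis_def)
      then show ?thesis by (rule that)
    qed
    \<comment> \<open>Bracketing every \<open>f j\<close> within \<open>e\<close> changes the
      weighted sum by at most \<open>e * A\<close>. The gap below \<open>c \<beta>\<close> equals
      \<open>e * (1 + A)\<close>, so strictness survives.\<close>
    define A where "A = (\<Sum>j\<in>UNIV. \<bar>a j\<bar>)"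
    define e where "e = (c \<beta> - (cmod z + (\<Sum>j\<in>UNIV. a j * f j z \<beta>))) / (1 + A)"
    have "0 \<le> A" unfolding A_def by (simp add: sum_nonneg)
    have "0 < e" using z(2) \<open>0 \<le> A\<close> unfolding e_def by simp
    have "e * (1 + A) = c \<beta> - (cmod z + (\<Sum>j\<in>UNIV. a j * f j z \<beta>))"
      using \<open>0 \<le> A\<close> unfolding e_def by simp
    then have eA: "cmod z + (\<Sum>j\<in>UNIV. a j * f j z \<beta>) + e * A < c \<beta>"
      using \<open>0 < e\<close> by (simp add: algebra_simps)
    have "\<exists>q. f j z \<beta> < of_rat q \<and> of_rat q < f j z \<beta> + e" for j
      using of_rat_dense \<open>0 < e\<close> by (metis less_add_same_cancel1)
    then obtain r where r: "\<And>j. f j z \<beta> < of_rat (r j)" "\<And>j. of_rat (r j) < f j z \<beta> + e" by metis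
    have "\<exists>q. f j z \<beta> - e < of_rat q \<and> of_rat q < f j z \<beta>" for j
      using of_rat_dense \<open>0 < e\<close> by (metis diff_less_eq less_add_same_cancel1)
    then obtain s where s: "\<And>j. f j z \<beta> - e < of_rat (s j)" "\<And>j. of_rat (s j) < f j z \<beta>" by metis
    \<comment> \<open>By lower semicontinuity the strict lower bounds at \<open>t0\<close> persist
      nearby, hence on a whole arc with rational ends around \<open>t0\<close>.\<close>
    have "open (\<Inter>j. {t. of_rat (s j) < f j (\<gamma> b t) \<beta>})"
    proof (intro open_INT finite ballI)
      fix j
      have "open (\<gamma> b -` {y. of_rat (s j) < f j y \<beta>})"
        using normal_integrand_open_Collect_greater[OF f \<beta>] \<gamma>(1) by (intro open_vimage)
      then show "open {t. of_rat (s j) < f j (\<gamma> b t) \<beta>}" by (simp add: vimage_def)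
    qed
    moreover have "t0 \<in> (\<Inter>j. {t. of_rat (s j) < f j (\<gamma> b t) \<beta>})" using s(2) bt by simp
    ultimately obtain d where d: "d > 0" "\<And>t. dist t t0 < d \<Longrightarrow> t \<in> (\<Inter>j. {t. of_rat (s j) < f j (\<gamma> b t) \<beta>})"
      unfolding open_dist by blast
    obtain u where u: "t0 - d < of_rat u" "of_rat u < t0"
      using of_rat_dense[of "t0 - d" t0] d(1) by auto
    obtain v where v: "t0 < of_rat v" "of_rat v < t0 + d"
      using of_rat_dense[of t0 "t0 + d"] d(1) by auto
    have "\<forall>t\<in>{of_rat u..of_rat v}. \<forall>j. of_rat (s j) < f j (\<gamma> b t) \<beta>"
    proof
      fix t :: real assume "t \<in> {of_rat u..of_rat v}"
      then have "dist t t0 < d" using u v by (auto simp: dist_real_def)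
      then show "\<forall>j. of_rat (s j) < f j (\<gamma> b t) \<beta>" using d(2) by blast
    qed
    moreover have "\<exists>t\<in>{of_rat u..of_rat v}. \<forall>j. f j (\<gamma> b t) \<beta> \<le> of_rat (r j)"
      using u v r(1) bt by (intro bexI[of _ t0]) (auto intro: less_imp_le)
    moreover have "(\<Sum>j\<in>UNIV. if 0 \<le> a j then a j * of_rat (r j) else a j * of_rat (s j))
        \<le> (\<Sum>j\<in>UNIV. a j * f j z \<beta> + \<bar>a j\<bar> * e)"
    proof (intro sum_mono)
      fix j
      have "a j * of_rat (r j) \<le> a j * (f j z \<beta> + e)" if "0 \<le> a j"
        using r(2)[of j] that by (intro mult_left_mono) auto
      moreover have "a j * of_rat (s j) \<le> a j * (f j z \<beta> - e)" if "\<not> 0 \<le> a j"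
        using s(1)[of j] that by (intro mult_left_mono_neg) auto
      ultimately show "(if 0 \<le> a j then a j * of_rat (r j) else a j * of_rat (s j)) \<le> a j * f j z \<beta> + \<bar>a j\<bar> * e"
        by (auto simp: algebra_simps)
    qed
    moreover have "(\<Sum>j\<in>UNIV. a j * f j z \<beta> + \<bar>a j\<bar> * e) = (\<Sum>j\<in>UNIV. a j * f j z \<beta>) + e * A"
      by (simp add: A_def sum.distrib sum_distrib_left mult.commute)
    moreover have "cmod z = (if b then \<Gamma> else 0)" using \<gamma>(2) bt by simp
    ultimately have "\<beta> \<in> B (b, (u, v), r, s)"
      using Q[of "(b, (u, v), r, s)"] \<beta> eA by simp
    then obtain i where "\<beta> \<in> B i" "Y \<beta> = y i \<beta>" using Y(3)[of \<beta>] by blast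
    then show ?thesis using yB_less[of \<beta> i] by simp
  qed
  ultimately show ?thesis using that Y(1) by blast
qed

section \<open>Saturated functions\<close>

definition bang_bang :: "(real^'n) set \<Rightarrow> real \<Rightarrow> (real^'n \<Rightarrow> complex) set" where
  "bang_bang \<Omega> \<Gamma> = {Y \<in> borel_measurable (lebesgue_on \<Omega>). \<forall>\<beta>\<in>\<Omega>. Y \<beta> = 0 \<or> cmod (Y \<beta>) = \<Gamma>}"

text \<open>The slack \<^term>\<open>s\<close> forces a functional bounded below on this set to have a nonnegative
  first coefficient.\<close>

definition bang_bang_values ::
    "(real^'n) set \<Rightarrow> (complex \<Rightarrow> real^'n \<Rightarrow> complex^'p) \<Rightarrow> real \<Rightarrow> (real \<times> (complex^'p)) set" where
  "bang_bang_values \<Omega> F \<Gamma> =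
     {((LINT \<beta>|lebesgue_on \<Omega>. cmod (Y \<beta>)) + s, LINT \<beta>|lebesgue_on \<Omega>. F (Y \<beta>) \<beta>) | Y s.
        Y \<in> bang_bang \<Omega> \<Gamma> \<and> 0 \<le> s}"

lemma bang_bang_admissible:
  assumes "0 \<le> \<Gamma>" "Y \<in> bang_bang \<Omega> \<Gamma>" shows "Y \<in> admissible \<Omega> \<Gamma>"
proof -
  have "AE \<beta> in lebesgue_on \<Omega>. cmod (Y \<beta>) \<le> \<Gamma>"
    using assms by (intro AE_I2) (auto simp: bang_bang_def)
  then show ?thesis using assms(2) by (auto simp: admissible_def L_infty_def bang_bang_def)
qed

lemma admissible_integrable_cmod:
  assumes "\<Omega> \<in> lmeasurable" "X \<in> admissible \<Omega> \<Gamma>"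
  shows "integrable (lebesgue_on \<Omega>) (\<lambda>\<beta>. cmod (X \<beta>))"
proof (rule finite_measure.integrable_const_bound[OF finite_measure_lebesgue_on[OF assms(1)], of _ \<Gamma>])
  show "(\<lambda>\<beta>. cmod (X \<beta>)) \<in> borel_measurable (lebesgue_on \<Omega>)"
    using assms(2) by (auto simp: admissible_def L_infty_def)
qed (use assms(2) in \<open>simp add: admissible_def\<close>)

text \<open>Pasting \<open>Y1\<close> on a set \<open>A\<close> with \<open>Y2\<close> off it keeps
  the values saturated. Applying \<open>approx_Lyapunov\<close> to the difference of the pairs
  (cost, constraint integrand) provides a single \<open>A\<close> that realizes the weight
  \<open>t\<close> approximately in both components.\<close>

lemma convex_closure_bang_bang_values:
  fixes F :: "complex \<Rightarrow> real^'n \<Rightarrow> complex^'p"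
  assumes \<Omega>: "compact \<Omega>" and \<Gamma>: "0 \<le> \<Gamma>"
    and F: "\<And>X. X \<in> admissible \<Omega> \<Gamma> \<Longrightarrow> integrable (lebesgue_on \<Omega>) (\<lambda>\<beta>. F (X \<beta>) \<beta>)"
  shows "convex (closure (bang_bang_values \<Omega> F \<Gamma>))"
proof (rule convex_closureI)
  let ?M = "lebesgue_on \<Omega>"
  fix v1 v2 and t :: real
  assume v: "v1 \<in> bang_bang_values \<Omega> F \<Gamma>" "v2 \<in> bang_bang_values \<Omega> F \<Gamma>" and t: "0 \<le> t" "t \<le> 1"
  from v obtain Y1 s1 Y2 s2 where Y1: "Y1 \<in> bang_bang \<Omega> \<Gamma>" "0 \<le> s1"
    and v1: "v1 = ((LINT \<beta>|?M. cmod (Y1 \<beta>)) + s1, LINT \<beta>|?M. F (Y1 \<beta>) \<beta>)"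
    and Y2: "Y2 \<in> bang_bang \<Omega> \<Gamma>" "0 \<le> s2"
    and v2: "v2 = ((LINT \<beta>|?M. cmod (Y2 \<beta>)) + s2, LINT \<beta>|?M. F (Y2 \<beta>) \<beta>)"
    unfolding bang_bang_values_def by blast
  have \<Omega>lm: "\<Omega> \<in> lmeasurable" using \<Omega> by (rule lmeasurable_compact)
  define V where "V Y \<beta> = (cmod (Y \<beta>), F (Y \<beta>) \<beta>)" for Y \<beta>
  have V: "integrable ?M (V Y)"
      "(LINT \<beta>|?M. V Y \<beta>) = (LINT \<beta>|?M. cmod (Y \<beta>), LINT \<beta>|?M. F (Y \<beta>) \<beta>)"
    if "Y \<in> bang_bang \<Omega> \<Gamma>" for Y
  proof -
    have 1: "integrable ?M (\<lambda>\<beta>. cmod (Y \<beta>))" "integrable ?M (\<lambda>\<beta>. F (Y \<beta>) \<beta>)"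
      using bang_bang_admissible[OF \<Gamma> that] admissible_integrable_cmod[OF \<Omega>lm] F by auto
    have 2: "V Y = (\<lambda>\<beta>. (cmod (Y \<beta>), 0) + (0, F (Y \<beta>) \<beta>))" by (auto simp: V_def)
    have bl: "bounded_linear (\<lambda>x::real. (x, 0 :: complex^'p))" "bounded_linear (\<lambda>x::complex^'p. (0::real, x))"
      by (auto intro!: bounded_linear_Pair bounded_linear_ident bounded_linear_zero)
    have 3: "integrable ?M (\<lambda>\<beta>. (cmod (Y \<beta>), 0 :: complex^'p))" "integrable ?M (\<lambda>\<beta>. (0::real, F (Y \<beta>) \<beta>))"
      using integrable_bounded_linear[OF bl(1) 1(1)] integrable_bounded_linear[OF bl(2) 1(2)] by auto
    show "integrable ?M (V Y)" unfolding 2 using 3 by (rule Bochner_Integration.integrable_add)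
    show "(LINT \<beta>|?M. V Y \<beta>) = (LINT \<beta>|?M. cmod (Y \<beta>), LINT \<beta>|?M. F (Y \<beta>) \<beta>)"
      unfolding 2 Bochner_Integration.integral_add[OF 3]
        integral_bounded_linear[OF bl(1) 1(1)] integral_bounded_linear[OF bl(2) 1(2)] by simp
  qed
  have i12: "integrable ?M (\<lambda>\<beta>. V Y1 \<beta> - V Y2 \<beta>)" using V(1) Y1(1) Y2(1) by auto
  let ?s = "t * s1 + (1 - t) * s2"
  show "t *\<^sub>R v1 + (1 - t) *\<^sub>R v2 \<in> closure (bang_bang_values \<Omega> F \<Gamma>)"
    unfolding closure_approachable
  proof (intro allI impI)
    fix e :: real assume "0 < e"
    then obtain A where A: "A \<in> sets ?M"
      "norm ((LINT \<beta>|?M. indicator A \<beta> *\<^sub>R (V Y1 \<beta> - V Y2 \<beta>)) - t *\<^sub>R (LINT \<beta>|?M. V Y1 \<beta> - V Y2 \<beta>)) < e"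
      using approx_Lyapunov[OF _ compact_imp_bounded[OF \<Omega>] i12 t] \<Omega>lm by blast
    define Y where "Y \<beta> = (if \<beta> \<in> A then Y1 \<beta> else Y2 \<beta>)" for \<beta>
    have "A \<inter> space ?M \<in> sets ?M" using A(1) by auto
    then have Y: "Y \<in> bang_bang \<Omega> \<Gamma>"
      using Y1 Y2 unfolding bang_bang_def Y_def by (auto intro!: measurable_If_set)
    have "V Y = (\<lambda>\<beta>. indicator A \<beta> *\<^sub>R (V Y1 \<beta> - V Y2 \<beta>) + V Y2 \<beta>)"
      by (auto simp: V_def Y_def indicator_def)
    then have 1: "(LINT \<beta>|?M. V Y \<beta>) = (LINT \<beta>|?M. indicator A \<beta> *\<^sub>R (V Y1 \<beta> - V Y2 \<beta>)) + (LINT \<beta>|?M. V Y2 \<beta>)"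
      using integrable_mult_indicator[OF A(1) i12] V(1)[OF Y2(1)] by simp
    have 2: "t *\<^sub>R (LINT \<beta>|?M. V Y1 \<beta> - V Y2 \<beta>) = t *\<^sub>R (LINT \<beta>|?M. V Y1 \<beta>) - t *\<^sub>R (LINT \<beta>|?M. V Y2 \<beta>)"
      using V(1) Y1(1) Y2(1) by (simp add: scaleR_right_diff_distrib)
    have 3: "t *\<^sub>R v1 + (1 - t) *\<^sub>R v2
        = t *\<^sub>R (LINT \<beta>|?M. V Y1 \<beta>) + (1 - t) *\<^sub>R (LINT \<beta>|?M. V Y2 \<beta>) + (?s, 0)"
      unfolding v1 v2 V(2)[OF Y1(1)] V(2)[OF Y2(1)] by (simp add: algebra_simps)
    have "(LINT \<beta>|?M. V Y \<beta>) + (?s, 0) - (t *\<^sub>R v1 + (1 - t) *\<^sub>R v2)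
        = (LINT \<beta>|?M. indicator A \<beta> *\<^sub>R (V Y1 \<beta> - V Y2 \<beta>)) - t *\<^sub>R (LINT \<beta>|?M. V Y1 \<beta> - V Y2 \<beta>)"
      unfolding 1 2 3 by (simp add: scaleR_left_diff_distrib)
    then have "dist ((LINT \<beta>|?M. V Y \<beta>) + (?s, 0)) (t *\<^sub>R v1 + (1 - t) *\<^sub>R v2) < e"
      using A(2) by (simp only: dist_norm)
    moreover have "(LINT \<beta>|?M. V Y \<beta>) + (?s, 0) \<in> bang_bang_values \<Omega> F \<Gamma>"
      unfolding V(2)[OF Y] bang_bang_values_def using Y Y1 Y2 t by force
    ultimately show "\<exists>y\<in>bang_bang_values \<Omega> F \<Gamma>. dist y (t *\<^sub>R v1 + (1 - t) *\<^sub>R v2) < e" by blast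
  qed
qed

text \<open>The real inner product with \<open>w\<close> is a real combination of the real and
  imaginary parts of the components, so the selection result applies with index set
  \<open>'p \<times> bool\<close>.\<close>

lemma bang_bang_selection:
  fixes F :: "complex \<Rightarrow> real^'n \<Rightarrow> complex^'p"
  assumes Re: "\<And>k. normal_integrand (lebesgue_on \<Omega>) (\<lambda>x \<beta>. Re (F x \<beta> $ k))"
    and Im: "\<And>k. normal_integrand (lebesgue_on \<Omega>) (\<lambda>x \<beta>. Im (F x \<beta> $ k))"
    and \<Gamma>: "0 \<le> \<Gamma>" and c: "c \<in> borel_measurable (lebesgue_on \<Omega>)"
  obtains Y where "Y \<in> bang_bang \<Omega> \<Gamma>"
    "\<And>\<beta> y. \<lbrakk>\<beta> \<in> \<Omega>; y = 0 \<or> cmod y = \<Gamma>; cmod y + w \<bullet> F y \<beta> < c \<beta>\<rbrakk> \<Longrightarrow> cmod (Y \<beta>) + w \<bullet> F (Y \<beta>) \<beta> < c \<beta>"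
proof -
  define f where "f = (\<lambda>(k, b) x \<beta>. if b then Re (F x \<beta> $ k) else Im (F x \<beta> $ k))"
  define a where "a = (\<lambda>(k, b). if b then Re (w $ k) else Im (w $ k))"
  have f: "normal_integrand (lebesgue_on \<Omega>) (f j)" for j
    using Re Im unfolding f_def by (cases j; cases "snd j") auto
  have sum: "(\<Sum>j\<in>UNIV. a j * f j y \<beta>) = w \<bullet> F y \<beta>" for y \<beta>
  proof -
    have "(\<Sum>j\<in>UNIV. a j * f j y \<beta>) = (\<Sum>k\<in>UNIV. \<Sum>b\<in>UNIV. a (k, b) * f (k, b) y \<beta>)"
      unfolding UNIV_Times_UNIV[symmetric] by (simp add: sum.cartesian_product del: UNIV_Times_UNIV)
    also have "\<dots> = w \<bullet> F y \<beta>"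
      by (simp add: a_def f_def UNIV_bool inner_vec_def inner_complex_def add.commute)
    finally show ?thesis .
  qed
  obtain Y where "Y \<in> borel_measurable (lebesgue_on \<Omega>)" "\<And>\<beta>. Y \<beta> = 0 \<or> cmod (Y \<beta>) = \<Gamma>"
    "\<And>\<beta> y. \<lbrakk>\<beta> \<in> space (lebesgue_on \<Omega>); y = 0 \<or> cmod y = \<Gamma>; cmod y + (\<Sum>j\<in>UNIV. a j * f j y \<beta>) < c \<beta>\<rbrakk>
      \<Longrightarrow> cmod (Y \<beta>) + (\<Sum>j\<in>UNIV. a j * f j (Y \<beta>) \<beta>) < c \<beta>"
    using normal_integrand_selection[of "lebesgue_on \<Omega>" f c \<Gamma> a, OF f c \<Gamma>] by blast
  then show ?thesis using that[of Y] by (auto simp: sum bang_bang_def)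
qed

text \<open>A separating functional has the form \<open>(\<alpha>, w)\<close> with \<open>\<alpha> \<ge> 0\<close>; since
  the first coordinates are nonnegative, \<open>\<alpha>\<close> can be increased slightly to become positive, and
  after rescaling the pointwise minimizers contradict the separation.\<close>

lemma admissible_in_closure_bang_bang_values:
  fixes F :: "complex \<Rightarrow> real^'n \<Rightarrow> complex^'p"
  assumes \<Omega>: "compact \<Omega>" and \<Gamma>: "0 \<le> \<Gamma>"
    and Re: "\<And>k. normal_integrand (lebesgue_on \<Omega>) (\<lambda>x \<beta>. Re (F x \<beta> $ k))"
    and Im: "\<And>k. normal_integrand (lebesgue_on \<Omega>) (\<lambda>x \<beta>. Im (F x \<beta> $ k))"
    and F: "\<And>X. X \<in> admissible \<Omega> \<Gamma> \<Longrightarrow> integrable (lebesgue_on \<Omega>) (\<lambda>\<beta>. F (X \<beta>) \<beta>)"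
    and sat: "\<And>w \<beta> x. \<lbrakk>\<beta> \<in> \<Omega>; cmod x \<le> \<Gamma>\<rbrakk> \<Longrightarrow>
      \<exists>y. (y = 0 \<or> cmod y = \<Gamma>) \<and> cmod y + w \<bullet> F y \<beta> \<le> cmod x + w \<bullet> F x \<beta>"
    and X: "X \<in> admissible \<Omega> \<Gamma>"
  shows "(LINT \<beta>|lebesgue_on \<Omega>. cmod (X \<beta>), LINT \<beta>|lebesgue_on \<Omega>. F (X \<beta>) \<beta>)
    \<in> closure (bang_bang_values \<Omega> F \<Gamma>)"
proof (rule ccontr)
  let ?M = "lebesgue_on \<Omega>"
  let ?P = "LINT \<beta>|?M. cmod (X \<beta>)" and ?z = "LINT \<beta>|?M. F (X \<beta>) \<beta>"
  have conv: "convex (closure (bang_bang_values \<Omega> F \<Gamma>))"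
    using convex_closure_bang_bang_values[of \<Omega> \<Gamma> F, OF \<Omega> \<Gamma> F] .
  assume "(?P, ?z) \<notin> closure (bang_bang_values \<Omega> F \<Gamma>)"
  then obtain p b where p: "p \<bullet> (?P, ?z) < b"
    and sep: "\<And>v. v \<in> closure (bang_bang_values \<Omega> F \<Gamma>) \<Longrightarrow> b < p \<bullet> v"
    using separating_hyperplane_closed_point[OF conv closed_closure] by blast
  obtain \<alpha> w where pw: "p = (\<alpha>, w)" by (cases p)
  have \<Omega>lm: "\<Omega> \<in> lmeasurable" using \<Omega> by (rule lmeasurable_compact)
  interpret finite_measure ?M using finite_measure_lebesgue_on[OF \<Omega>lm] .
  have sepY: "b < \<alpha> * ((LINT \<beta>|?M. cmod (Y \<beta>)) + s) + w \<bullet> (LINT \<beta>|?M. F (Y \<beta>) \<beta>)"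
    if "Y \<in> bang_bang \<Omega> \<Gamma>" "0 \<le> s" for Y s
    using sep[OF subsetD[OF closure_subset], of "((LINT \<beta>|?M. cmod (Y \<beta>)) + s, LINT \<beta>|?M. F (Y \<beta>) \<beta>)"] that
    by (auto simp: bang_bang_values_def pw)
  have "0 \<le> \<alpha>"
  proof (rule ccontr)
    assume "\<not> 0 \<le> \<alpha>"
    have Z: "(\<lambda>_. 0) \<in> bang_bang \<Omega> \<Gamma>" by (simp add: bang_bang_def)
    \<comment> \<open>The slack \<open>d / - \<alpha>\<close> at the zero function would give the
      functional exactly the value \<open>b\<close>.\<close>
    define d where "d = w \<bullet> (LINT \<beta>|?M. F 0 \<beta>) - b"
    have "0 < d" using sepY[OF Z, of 0] by (simp add: d_def)
    then have "0 \<le> d / - \<alpha>" using \<open>\<not> 0 \<le> \<alpha>\<close> by (simp add: divide_nonneg_neg)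
    from sepY[OF Z this] show False using \<open>\<not> 0 \<le> \<alpha>\<close> by (simp add: d_def)
  qed
  have "0 \<le> ?P" by simp
  \<comment> \<open>The increase of \<alpha> is chosen to cost at most half of the separation gap at
    \<open>X\<close>; the 1 in the denominator covers a vanishing \<open>?P\<close>.\<close>
  define \<alpha>' where "\<alpha>' = \<alpha> + (b - (\<alpha> * ?P + w \<bullet> ?z)) / (2 * (?P + 1))"
  have gap: "0 < b - (\<alpha> * ?P + w \<bullet> ?z)" using p by (simp add: pw)
  then have "\<alpha> < \<alpha>'" "0 < \<alpha>'" using \<open>0 \<le> \<alpha>\<close> \<open>0 \<le> ?P\<close> by (simp_all add: \<alpha>'_def add_nonneg_pos)
  have gap': "\<alpha>' * ?P + w \<bullet> ?z < b"
  proof -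
    have "(\<alpha>' - \<alpha>) * ?P \<le> (\<alpha>' - \<alpha>) * (?P + 1)"
      using \<open>\<alpha> < \<alpha>'\<close> by (intro mult_left_mono) auto
    also have "\<dots> = (b - (\<alpha> * ?P + w \<bullet> ?z)) / 2"
    proof -
      have "x / (2 * q) * q = x / 2" if "q \<noteq> 0" for x q :: real using that by simp
      moreover have "?P + 1 \<noteq> 0" using \<open>0 \<le> ?P\<close> by linarith
      ultimately show ?thesis unfolding \<alpha>'_def by (simp only: add_diff_cancel_left')
    qed
    finally show ?thesis using gap by (simp add: algebra_simps)
  qed
  define m where "m = measure ?M (space ?M)"
  have "0 \<le> m" by (simp add: m_def)
  \<comment> \<open>A uniform pointwise loss \<epsilon> over \<Omega>, scaled by
    \<open>\<alpha>'\<close>, stays below the remaining gap; \<open>m + 1\<close> is used because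
    \<Omega> may be null.\<close>
  define \<epsilon> where "\<epsilon> = (b - (\<alpha>' * ?P + w \<bullet> ?z)) / (\<alpha>' * (m + 1))"
  have "0 < \<epsilon>" using gap' \<open>0 < \<alpha>'\<close> \<open>0 \<le> m\<close> by (simp add: \<epsilon>_def)
  have "\<alpha>' * \<epsilon> * (m + 1) = b - (\<alpha>' * ?P + w \<bullet> ?z)"
  proof -
    have "a * (x / (a * q)) * q = x" if "a \<noteq> 0" "q \<noteq> 0" for a q x :: real using that by simp
    moreover have "\<alpha>' \<noteq> 0" "m + 1 \<noteq> 0" using \<open>0 < \<alpha>'\<close> \<open>0 \<le> m\<close> by linarith+
    ultimately show ?thesis unfolding \<epsilon>_def by blast
  qed
  moreover have "\<alpha>' * \<epsilon> * m < \<alpha>' * \<epsilon> * (m + 1)" using \<open>0 < \<alpha>'\<close> \<open>0 < \<epsilon>\<close> by simp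
  ultimately have \<epsilon>: "\<alpha>' * ?P + w \<bullet> ?z + \<alpha>' * (\<epsilon> * m) < b" by (simp add: algebra_simps)
  \<comment> \<open>Dividing by \<open>\<alpha>'\<close> gives the modulus the coefficient 1 that it
    has in the pointwise Lagrangian.\<close>
  define w' where "w' = w /\<^sub>R \<alpha>'"
  have w': "w = \<alpha>' *\<^sub>R w'" using \<open>0 < \<alpha>'\<close> by (simp add: w'_def)
  \<comment> \<open>The threshold is the Lagrangian at \<open>X\<close> plus \<epsilon>. Where
    \<open>X\<close> obeys its bound, \<open>sat\<close> puts some saturated value strictly below
    it, as the selection requires.\<close>
  define c where "c \<beta> = cmod (X \<beta>) + w' \<bullet> F (X \<beta>) \<beta> + \<epsilon>" for \<beta>
  have bl: "bounded_linear (\<lambda>v. w' \<bullet> v)" by (rule bounded_linear_inner_right)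
  have int: "integrable ?M (\<lambda>\<beta>. cmod (X \<beta>))" "integrable ?M (\<lambda>\<beta>. w' \<bullet> F (X \<beta>) \<beta>)"
    "(LINT \<beta>|?M. w' \<bullet> F (X \<beta>) \<beta>) = w' \<bullet> (LINT \<beta>|?M. F (X \<beta>) \<beta>)" if "X \<in> admissible \<Omega> \<Gamma>" for X
    using admissible_integrable_cmod[OF \<Omega>lm that] integrable_bounded_linear[OF bl F[OF that]]
      integral_bounded_linear[OF bl F[OF that]] by auto
  have c: "integrable ?M c" "(LINT \<beta>|?M. c \<beta>) = ?P + w' \<bullet> ?z + \<epsilon> * m"
    unfolding c_def using int[OF X] by (simp_all add: m_def mult.commute)
  obtain Y where Y: "Y \<in> bang_bang \<Omega> \<Gamma>"
    "\<And>\<beta> y. \<lbrakk>\<beta> \<in> \<Omega>; y = 0 \<or> cmod y = \<Gamma>; cmod y + w' \<bullet> F y \<beta> < c \<beta>\<rbrakk> \<Longrightarrow> cmod (Y \<beta>) + w' \<bullet> F (Y \<beta>) \<beta> < c \<beta>"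
    using bang_bang_selection[OF Re Im \<Gamma>, of c w'] c(1) by (metis borel_measurable_integrable)
  note Ya = bang_bang_admissible[OF \<Gamma> Y(1)]
  have "AE \<beta> in ?M. cmod (X \<beta>) \<le> \<Gamma>" using X by (simp add: admissible_def)
  then have "AE \<beta> in ?M. cmod (Y \<beta>) + w' \<bullet> F (Y \<beta>) \<beta> \<le> c \<beta>"
  proof (rule AE_mp, intro AE_I2 impI)
    fix \<beta> assume "\<beta> \<in> space ?M" and X\<beta>: "cmod (X \<beta>) \<le> \<Gamma>"
    then have \<beta>: "\<beta> \<in> \<Omega>" by simp
    from sat[OF this X\<beta>, of w'] obtain y where "y = 0 \<or> cmod y = \<Gamma>" "cmod y + w' \<bullet> F y \<beta> < c \<beta>"
      using \<open>0 < \<epsilon>\<close> unfolding c_def by fastforce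
    from Y(2)[OF \<beta> this] show "cmod (Y \<beta>) + w' \<bullet> F (Y \<beta>) \<beta> \<le> c \<beta>" by simp
  qed
  then have "(LINT \<beta>|?M. cmod (Y \<beta>) + w' \<bullet> F (Y \<beta>) \<beta>) \<le> (LINT \<beta>|?M. c \<beta>)"
    using int[OF Ya] c(1) by (intro integral_mono_AE) auto
  then have "(LINT \<beta>|?M. cmod (Y \<beta>)) + w' \<bullet> (LINT \<beta>|?M. F (Y \<beta>) \<beta>) \<le> ?P + w' \<bullet> ?z + \<epsilon> * m"
    using int[OF Ya] c(2) by simp
  then have "\<alpha>' * ((LINT \<beta>|?M. cmod (Y \<beta>)) + w' \<bullet> (LINT \<beta>|?M. F (Y \<beta>) \<beta>)) \<le> \<alpha>' * (?P + w' \<bullet> ?z + \<epsilon> * m)"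
    using \<open>0 < \<alpha>'\<close> by (intro mult_left_mono) auto
  then have "\<alpha>' * (LINT \<beta>|?M. cmod (Y \<beta>)) + w \<bullet> (LINT \<beta>|?M. F (Y \<beta>) \<beta>) \<le> \<alpha>' * ?P + w \<bullet> ?z + \<alpha>' * (\<epsilon> * m)"
    by (simp add: w' algebra_simps)
  \<comment> \<open>The cost of \<open>Y\<close> is nonnegative, so the lower bound from separation
    with \<alpha> also holds with \<open>\<alpha>'\<close>.\<close>
  moreover have "\<alpha> * (LINT \<beta>|?M. cmod (Y \<beta>)) \<le> \<alpha>' * (LINT \<beta>|?M. cmod (Y \<beta>))"
    using \<open>\<alpha> < \<alpha>'\<close> by (intro mult_right_mono) auto
  ultimately show False using sepY[OF Y(1), of 0] \<epsilon> by simp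
qed

section \<open>Comparison of the two objectives\<close>

lemma L1_norm_admissible:
  assumes "\<Omega> \<in> lmeasurable" "X \<in> admissible \<Omega> \<Gamma>"
  shows "L1_norm \<Omega> X = ennreal (LINT \<beta>|lebesgue_on \<Omega>. cmod (X \<beta>))"
  unfolding L1_norm_def using admissible_integrable_cmod[OF assms] by (intro nn_integral_eq_integral) auto

lemma L0_norm_eq_nn_integral:
  assumes "\<Omega> \<in> lmeasurable" "X \<in> borel_measurable (lebesgue_on \<Omega>)"
  shows "ennreal \<Gamma> * L0_norm \<Omega> X = (\<integral>\<^sup>+\<beta>. ennreal \<Gamma> * indicator {\<beta> \<in> \<Omega>. X \<beta> \<noteq> 0} \<beta> \<partial>lebesgue_on \<Omega>)"
proof -
  have "{\<beta> \<in> space (lebesgue_on \<Omega>). X \<beta> \<noteq> 0} \<in> sets (lebesgue_on \<Omega>)"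
    using assms(2) by measurable
  then have "{\<beta> \<in> \<Omega>. X \<beta> \<noteq> 0} \<in> sets (lebesgue_on \<Omega>)" by simp
  moreover have "emeasure (lebesgue_on \<Omega>) {\<beta> \<in> \<Omega>. X \<beta> \<noteq> 0} = L0_norm \<Omega> X"
    unfolding L0_norm_def using assms(1) by (intro emeasure_restrict_space) auto
  ultimately show ?thesis by (simp add: nn_integral_cmult_indicator)
qed

text \<open>Almost everywhere the modulus is at most \<Gamma> times the indicator of the support.
  This gives the easy inequality between the optimal values.\<close>

lemma L1_norm_le_L0_norm:
  assumes "\<Omega> \<in> lmeasurable" "X \<in> admissible \<Omega> \<Gamma>"
  shows "L1_norm \<Omega> X \<le> ennreal \<Gamma> * L0_norm \<Omega> X"
proof -
  have X: "X \<in> borel_measurable (lebesgue_on \<Omega>)" "AE \<beta> in lebesgue_on \<Omega>. cmod (X \<beta>) \<le> \<Gamma>"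
    using assms(2) by (auto simp: admissible_def L_infty_def)
  show ?thesis
    unfolding L1_norm_def L0_norm_eq_nn_integral[OF assms(1) X(1)]
  proof (rule nn_integral_mono_AE)
    show "AE \<beta> in lebesgue_on \<Omega>. ennreal (cmod (X \<beta>)) \<le> ennreal \<Gamma> * indicator {\<beta> \<in> \<Omega>. X \<beta> \<noteq> 0} \<beta>"
      using X(2) by (rule AE_mp) (auto intro!: AE_I2 simp: indicator_def ennreal_leI)
  qed
qed

lemma L1_norm_eq_L0_norm_bang_bang:
  assumes "\<Omega> \<in> lmeasurable" "Y \<in> bang_bang \<Omega> \<Gamma>"
  shows "L1_norm \<Omega> Y = ennreal \<Gamma> * L0_norm \<Omega> Y"
proof -
  have Y: "Y \<in> borel_measurable (lebesgue_on \<Omega>)" "\<forall>\<beta>\<in>\<Omega>. Y \<beta> = 0 \<or> cmod (Y \<beta>) = \<Gamma>"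
    using assms(2) by (auto simp: bang_bang_def)
  show ?thesis
    unfolding L1_norm_def L0_norm_eq_nn_integral[OF assms(1) Y(1)]
    using Y(2) by (intro nn_integral_cong) (auto simp: indicator_def)
qed

section \<open>Equality of the optimal values\<close>

theorem proposition3:
  fixes \<Omega> :: "(real^'n) set"
    and F :: "complex \<Rightarrow> real^'n \<Rightarrow> complex^'p"
    and m :: nat
    and g :: "nat \<Rightarrow> complex^'p \<Rightarrow> real"
    and \<Gamma> :: real
    and xo :: "complex^'p \<Rightarrow> real^'n \<Rightarrow> complex"
  assumes "compact \<Omega>"
    and "\<Gamma> > 0"
    and "\<And>i. i \<in> {1..m} \<Longrightarrow> convex_on UNIV (g i)"
    and "\<And>k. normal_integrand (lebesgue_on \<Omega>) (\<lambda>x \<beta>. Re (F x \<beta> $ k))"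
    and "\<And>k. normal_integrand (lebesgue_on \<Omega>) (\<lambda>x \<beta>. Im (F x \<beta> $ k))"
    and "\<And>X. X \<in> admissible \<Omega> \<Gamma> \<Longrightarrow> integrable (lebesgue_on \<Omega>) (\<lambda>\<beta>. F (X \<beta>) \<beta>)"
    and minimizer: "\<And>\<mu> \<beta>. \<beta> \<in> \<Omega> \<Longrightarrow>
          is_arg_min (scalar_lagrangian F \<mu> \<beta>) (\<lambda>x. cmod x \<le> \<Gamma>) (xo \<mu> \<beta>)"
    and saturation: "\<And>\<mu> \<beta>. \<beta> \<in> \<Omega> \<Longrightarrow> xo \<mu> \<beta> \<noteq> 0 \<Longrightarrow> cmod (xo \<mu> \<beta>) = \<Gamma>"
    and slater: "\<exists>X' z'. X' \<in> admissible \<Omega> \<Gamma> \<and>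
          z' = (LINT \<beta>|lebesgue_on \<Omega>. F (X' \<beta>) \<beta>) \<and>
          (\<forall>i\<in>{1..m}. g i z' < 0)"
  shows "P0_star \<Omega> F m g \<Gamma> = P1_star \<Omega> F m g \<Gamma> / ennreal \<Gamma>"
proof -
  let ?M = "lebesgue_on \<Omega>"
  have \<Omega>lm: "\<Omega> \<in> lmeasurable" using assms(1) by (rule lmeasurable_compact)
  have "0 \<le> \<Gamma>" using assms(2) by simp
  have sat: "\<exists>y. (y = 0 \<or> cmod y = \<Gamma>) \<and> cmod y + w \<bullet> F y \<beta> \<le> cmod x + w \<bullet> F x \<beta>"
    if "\<beta> \<in> \<Omega>" "cmod x \<le> \<Gamma>" for w \<beta> x
  proof -
    \<comment> \<open>The real inner product conjugates one argument whereas
      \<open>scalar_product\<close> is bilinear; conjugating \<open>w\<close> makes every real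
      functional arise from some \<mu>.\<close>
    define \<mu> where "\<mu> = (\<chi> k. cnj (w $ k))"
    have "Re (scalar_product \<mu> v) = w \<bullet> v" for v
      by (simp add: scalar_product_def \<mu>_def inner_vec_def inner_complex_def)
    then have "scalar_lagrangian F \<mu> \<beta> y = cmod y + w \<bullet> F y \<beta>" for y
      by (simp add: scalar_lagrangian_def)
    then show ?thesis
      using minimizer[OF that(1), of \<mu>] saturation[OF that(1), of \<mu>] that(2)
      by (intro exI[of _ "xo \<mu> \<beta>"]) (auto simp: is_arg_min_def not_less)
  qed
  let ?C = "closure (bang_bang_values \<Omega> F \<Gamma>)"
  define V where "V X = (LINT \<beta>|?M. cmod (X \<beta>), LINT \<beta>|?M. F (X \<beta>) \<beta>)" for X
  have V: "V X \<in> ?C" if "X \<in> admissible \<Omega> \<Gamma>" for X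
    unfolding V_def
    using admissible_in_closure_bang_bang_values[OF assms(1) \<open>0 \<le> \<Gamma>\<close> assms(4-6) sat that] .
  have "convex ?C"
    using convex_closure_bang_bang_values[OF assms(1) \<open>0 \<le> \<Gamma>\<close> assms(6)] .
  obtain X' where X': "X' \<in> admissible \<Omega> \<Gamma>" "\<forall>i\<in>{1..m}. g i (snd (V X')) < 0"
    using slater by (auto simp: V_def)
  \<comment> \<open>The strictly feasible points form an open set because convex functions on a
    finite-dimensional space are continuous.\<close>
  define G where "G = (\<Inter>i\<in>{1..m}. {z. g i z < 0})"
  have "open G"
    unfolding G_def
    by (intro open_INT finite_atLeastAtMost ballI open_Collect_less convex_on_continuous assms(3) open_UNIV continuous_on_const)
  have main: "ennreal \<Gamma> * P0_star \<Omega> F m g \<Gamma> \<le> L1_norm \<Omega> X" if feas: "(X, z) \<in> feasible_set \<Omega> F m g \<Gamma>" for X z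
  proof (rule ennreal_le_epsilon)
    fix e :: real assume "0 < e"
    have X: "X \<in> admissible \<Omega> \<Gamma>" "\<forall>i\<in>{1..m}. g i (snd (V X)) \<le> 0"
      using feas by (auto simp: feasible_set_def V_def)
    \<comment> \<open>The step towards the Slater point is positive, at most 1, and adds at most
      \<open>e / 2\<close> to the cost; the 1 in the denominator covers zero cost of
      \<open>X'\<close>.\<close>
    define t where "t = min 1 (e / (2 * (1 + fst (V X'))))"
    have P': "0 \<le> fst (V X')" by (simp add: V_def)
    have t: "0 < t" "t \<le> 1" using \<open>0 < e\<close> P' by (auto simp: t_def)
    have "t * fst (V X') \<le> e / (2 * (1 + fst (V X'))) * (1 + fst (V X'))"
      using P' t by (intro mult_mono) (auto simp: t_def)
    also have "\<dots> = e / 2" using P' by (simp add: field_simps)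
    finally have tP': "t * fst (V X') \<le> e / 2" .
    \<comment> \<open>\<open>v\<close> need not be the value of an admissible function; it only lies
      in the convex closure, but its constraint part is strictly feasible by convexity of
      \<open>g\<close> and \<open>t > 0\<close>.\<close>
    define v where "v = (1 - t) *\<^sub>R V X + t *\<^sub>R V X'"
    have "v \<in> ?C"
      unfolding v_def using \<open>convex ?C\<close> V[OF X(1)] V[OF X'(1)] t by (simp add: convex_alt)
    have "fst v \<le> fst (V X) + e / 2"
    proof -
      have "(1 - t) * fst (V X) \<le> fst (V X)"
        using t by (intro mult_left_le_one_le) (auto simp: V_def)
      then show ?thesis using tP' by (simp add: v_def)
    qed
    have "snd v \<in> G"
      unfolding G_def
    proof (intro INT_I CollectI)
      fix i assume i: "i \<in> {1..m}"
      have "g i (snd v) \<le> (1 - t) * g i (snd (V X)) + t * g i (snd (V X'))"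
        using convex_onD[OF assms(3)[OF i], of t "snd (V X)" "snd (V X')"] t by (simp add: v_def)
      moreover have "(1 - t) * g i (snd (V X)) \<le> 0"
        using t X(2) i by (simp add: mult_nonneg_nonpos)
      moreover have "t * g i (snd (V X')) < 0" using t X'(2) i by (simp add: mult_pos_neg)
      ultimately show "g i (snd v) < 0" by linarith
    qed
    then obtain d where d: "0 < d" "ball (snd v) d \<subseteq> G"
      using \<open>open G\<close> open_contains_ball by blast
    \<comment> \<open>One radius serves both components: \<open>d\<close> keeps the constraint part
      in \<open>G\<close>, and \<open>e / 2\<close> is the remaining allowance for the cost.\<close>
    define d' where "d' = min d (e / 2)"
    have "0 < d'" using d \<open>0 < e\<close> by (simp add: d'_def)
    then obtain u where u: "u \<in> bang_bang_values \<Omega> F \<Gamma>" "dist u v < d'"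
      using \<open>v \<in> ?C\<close> closure_approachable by blast
    then obtain Y s where Y: "Y \<in> bang_bang \<Omega> \<Gamma>" "0 \<le> s" "u = V Y + (s, 0)"
      by (auto simp: bang_bang_values_def V_def)
    have Ya: "Y \<in> admissible \<Omega> \<Gamma>" using bang_bang_admissible[OF \<open>0 \<le> \<Gamma>\<close> Y(1)] .
    have "dist (snd v) (snd u) < d" "dist (fst u) (fst v) < e / 2"
      using dist_snd_le[of v u] dist_fst_le[of u v] u(2) by (auto simp: d'_def dist_commute)
    then have "snd (V Y) \<in> G" and "dist (fst (V Y) + s) (fst v) < e / 2"
      using d(2) Y(3) by auto
    then have "fst (V Y) + s - fst v < e / 2" unfolding dist_real_def by linarith
    then have cost: "fst (V Y) \<le> fst (V X) + e"
      using Y(2) \<open>fst v \<le> fst (V X) + e / 2\<close> by linarith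
    from \<open>snd (V Y) \<in> G\<close> have "(Y, snd (V Y)) \<in> feasible_set \<Omega> F m g \<Gamma>"
      using Ya by (auto simp: feasible_set_def V_def G_def less_imp_le)
    then have "P0_star \<Omega> F m g \<Gamma> \<le> L0_norm \<Omega> Y"
      unfolding P0_star_def by (intro INF_lower2[of "(Y, snd (V Y))"]) auto
    then have "ennreal \<Gamma> * P0_star \<Omega> F m g \<Gamma> \<le> ennreal \<Gamma> * L0_norm \<Omega> Y" by (rule mult_left_mono) simp
    also have "\<dots> = ennreal (fst (V Y))"
      using L1_norm_eq_L0_norm_bang_bang[OF \<Omega>lm Y(1)] L1_norm_admissible[OF \<Omega>lm Ya] by (simp add: V_def)
    also have "\<dots> \<le> ennreal (fst (V X) + e)" using cost by (rule ennreal_leI)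
    also have "\<dots> = ennreal (fst (V X)) + ennreal e"
      using \<open>0 < e\<close> by (intro ennreal_plus) (auto simp: V_def)
    also have "ennreal (fst (V X)) = L1_norm \<Omega> X"
      using L1_norm_admissible[OF \<Omega>lm X(1)] by (simp add: V_def)
    finally show "ennreal \<Gamma> * P0_star \<Omega> F m g \<Gamma> \<le> L1_norm \<Omega> X + ennreal e" .
  qed
  have le: "ennreal \<Gamma> * P0_star \<Omega> F m g \<Gamma> \<le> P1_star \<Omega> F m g \<Gamma>"
    unfolding P1_star_def by (rule INF_greatest) (use main in auto)
  \<comment> \<open>The factor \<Gamma> cancels in \<open>ennreal\<close> because it is positive and
    finite, whether or not \<open>a\<close> is infinite.\<close>
  have inv: "ennreal \<Gamma> * a / ennreal \<Gamma> = a" for a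
    using assms(2) by (simp add: ennreal_mult_divide_eq mult.commute)
  have "P1_star \<Omega> F m g \<Gamma> / ennreal \<Gamma> \<le> L0_norm \<Omega> X" if "(X, z) \<in> feasible_set \<Omega> F m g \<Gamma>" for X z
  proof -
    have "P1_star \<Omega> F m g \<Gamma> \<le> L1_norm \<Omega> X"
      unfolding P1_star_def using that by (intro INF_lower2[of "(X, z)"]) auto
    also have "\<dots> \<le> ennreal \<Gamma> * L0_norm \<Omega> X"
      using that by (intro L1_norm_le_L0_norm \<Omega>lm) (auto simp: feasible_set_def)
    finally have "P1_star \<Omega> F m g \<Gamma> / ennreal \<Gamma> \<le> ennreal \<Gamma> * L0_norm \<Omega> X / ennreal \<Gamma>"
      by (rule divide_right_mono_ennreal)
    then show ?thesis by (simp only: inv)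
  qed
  then have ge: "P1_star \<Omega> F m g \<Gamma> / ennreal \<Gamma> \<le> P0_star \<Omega> F m g \<Gamma>"
    unfolding P0_star_def by (intro INF_greatest) auto
  have "P0_star \<Omega> F m g \<Gamma> \<le> P1_star \<Omega> F m g \<Gamma> / ennreal \<Gamma>"
    using divide_right_mono_ennreal[OF le, of "ennreal \<Gamma>"] by (simp only: inv)
  with ge show ?thesis by (rule antisym[rotated])
qed

end
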